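(* Every covering $P\colon\mathcal{E}\to\mathcal{B}$ of small categories is a bifibration.
   Context: For an object $C$ of a small category $\mathcal{C}$, let $\mathcal{U}_C$ be the set of morphisms of $\mathcal{C}$ with codomain $C$ and $\mathcal{F}_C$ the set of morphisms of $\mathcal{C}$ with domain $C$. A functor $P\colon\mathcal{E}\to\mathcal{B}$ induces maps $P_{\mathcal{U}_C}\colon\mathcal{U}_C\to\mathcal{U}_{P(C)}$ and $P_{\mathcal{F}_C}\colon\mathcal{F}_C\to\mathcal{F}_{P(C)}$, $f\mapsto P(f)$, for each object $C$ of $\mathcal{E}$. $P$ is a covering if it is surjective on objects and, for every object $C$ of $\mathcal{E}$, both $P_{\mathcal{U}_C}$ and $P_{\mathcal{F}_C}$ are bijective. For a functor $P\colon\mathcal{E}\to\mathcal{B}$, a morphism $\phi\colon e_1\to e_2$ of $\mathcal{E}$ is Cartesian if for all $\beta\colon e\to e_2$ in $\mathcal{E}$ and $\bar\alpha\colon Pe\to Pe_1$ in $\mathcal{B}$ with $P\phi\circ\bar\alpha=P\beta$ there is a unique $\alpha\colon e\to e_1$ with $\phi\circ\alpha=\beta$ and $P\alpha=\bar\alpha$. $P$ is a fibration if for each $\bar\phi\colon b_1\to b_2$ in $\mathcal{B}$ and each object $e_2$ with $Pe_2=b_2$ there is a Cartesian $\phi\colon e_1\to e_2$ with $P\phi=\bar\phi$. $P$ is an op-fibration if $P^{\mathrm{op}}\colon\mathcal{E}^{\mathrm{op}}\to\mathcal{B}^{\mathrm{op}}$ is a fibration, and a bifibration if it is both. *)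

theory Defs
  imports Main
begin

text \<open>
  The operations of a category are total functions; only their values on
  \<open>Obj\<close>, on \<open>Mor\<close>, and on composable pairs are constrained. \<open>Comp C g f\<close> is the
  composite \<open>g \<circ> f\<close> (first \<open>f\<close>, then \<open>g\<close>).
\<close>

record ('o, 'm) category =
  Obj :: "'o set"
  Mor :: "'m set"
  Dom :: "'m \<Rightarrow> 'o"
  Cod :: "'m \<Rightarrow> 'o"
  Id :: "'o \<Rightarrow> 'm"
  Comp :: "'m \<Rightarrow> 'm \<Rightarrow> 'm"

definition hom_set :: "('o, 'm) category \<Rightarrow> 'o \<Rightarrow> 'o \<Rightarrow> 'm set" where
  "hom_set C a b = {f \<in> Mor C. Dom C f = a \<and> Cod C f = b}"

locale small_category =
  fixes C :: "('o, 'm) category"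
  assumes Dom_Obj: "f \<in> Mor C \<Longrightarrow> Dom C f \<in> Obj C"
    and Cod_Obj: "f \<in> Mor C \<Longrightarrow> Cod C f \<in> Obj C"
    and Id_hom: "a \<in> Obj C \<Longrightarrow> Id C a \<in> hom_set C a a"
    and Comp_hom: "\<lbrakk>f \<in> hom_set C a b; g \<in> hom_set C b c\<rbrakk> \<Longrightarrow> Comp C g f \<in> hom_set C a c"
    and Comp_Id: "f \<in> hom_set C a b \<Longrightarrow> Comp C f (Id C a) = f"
    and Id_Comp: "f \<in> hom_set C a b \<Longrightarrow> Comp C (Id C b) f = f"
    and Comp_assoc: "\<lbrakk>f \<in> hom_set C a b; g \<in> hom_set C b c; h \<in> hom_set C c d\<rbrakk> \<Longrightarrow>
      Comp C h (Comp C g f) = Comp C (Comp C h g) f"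

definition opposite :: "('o, 'm) category \<Rightarrow> ('o, 'm) category" where
  "opposite C = \<lparr>Obj = Obj C, Mor = Mor C, Dom = Cod C, Cod = Dom C, Id = Id C,
     Comp = (\<lambda>g f. Comp C f g)\<rparr>"

record ('o, 'm, 'p, 'n) functor_maps =
  on_obj :: "'o \<Rightarrow> 'p"
  on_mor :: "'m \<Rightarrow> 'n"

locale cat_functor = E: small_category E + B: small_category B
  for E :: "('o, 'm) category" and B :: "('p, 'n) category"
    and P :: "('o, 'm, 'p, 'n) functor_maps" +
  assumes on_obj_Obj: "a \<in> Obj E \<Longrightarrow> on_obj P a \<in> Obj B"
    and on_mor_hom: "f \<in> hom_set E a b \<Longrightarrow> on_mor P f \<in> hom_set B (on_obj P a) (on_obj P b)"
    and on_mor_Id: "a \<in> Obj E \<Longrightarrow> on_mor P (Id E a) = Id B (on_obj P a)"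
    and on_mor_Comp: "\<lbrakk>f \<in> hom_set E a b; g \<in> hom_set E b c\<rbrakk> \<Longrightarrow>
      on_mor P (Comp E g f) = Comp B (on_mor P g) (on_mor P f)"

definition mor_into :: "('o, 'm) category \<Rightarrow> 'o \<Rightarrow> 'm set" where
  "mor_into C c = {f \<in> Mor C. Cod C f = c}"

definition mor_from :: "('o, 'm) category \<Rightarrow> 'o \<Rightarrow> 'm set" where
  "mor_from C c = {f \<in> Mor C. Dom C f = c}"

definition covering ::
  "('o, 'm) category \<Rightarrow> ('p, 'n) category \<Rightarrow> ('o, 'm, 'p, 'n) functor_maps \<Rightarrow> bool" where
  "covering E B P \<longleftrightarrow> cat_functor E B P \<and> on_obj P ` Obj E = Obj B \<and>
     (\<forall>c \<in> Obj E. bij_betw (on_mor P) (mor_into E c) (mor_into B (on_obj P c)) \<and>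
                  bij_betw (on_mor P) (mor_from E c) (mor_from B (on_obj P c)))"

definition cartesian ::
  "('o, 'm) category \<Rightarrow> ('p, 'n) category \<Rightarrow> ('o, 'm, 'p, 'n) functor_maps \<Rightarrow> 'm \<Rightarrow> bool" where
  "cartesian E B P \<phi> \<longleftrightarrow> \<phi> \<in> Mor E \<and>
     (\<forall>e \<in> Obj E. \<forall>\<beta> \<in> hom_set E e (Cod E \<phi>).
        \<forall>\<alpha>' \<in> hom_set B (on_obj P e) (on_obj P (Dom E \<phi>)).
          Comp B (on_mor P \<phi>) \<alpha>' = on_mor P \<beta> \<longrightarrow>
          (\<exists>!\<alpha>. \<alpha> \<in> hom_set E e (Dom E \<phi>) \<and> Comp E \<phi> \<alpha> = \<beta> \<and> on_mor P \<alpha> = \<alpha>'))"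

definition fibration ::
  "('o, 'm) category \<Rightarrow> ('p, 'n) category \<Rightarrow> ('o, 'm, 'p, 'n) functor_maps \<Rightarrow> bool" where
  "fibration E B P \<longleftrightarrow> cat_functor E B P \<and>
     (\<forall>b1 \<in> Obj B. \<forall>b2 \<in> Obj B. \<forall>\<phi>' \<in> hom_set B b1 b2. \<forall>e2 \<in> Obj E. on_obj P e2 = b2 \<longrightarrow>
        (\<exists>e1 \<in> Obj E. \<exists>\<phi> \<in> hom_set E e1 e2. cartesian E B P \<phi> \<and> on_mor P \<phi> = \<phi>'))"

text \<open>
  The opposite functor has the same action on objects and morphisms as \<open>P\<close>, so it is
  \<open>P\<close> itself, read between the opposite categories.
\<close>

definition op_fibration ::
  "('o, 'm) category \<Rightarrow> ('p, 'n) category \<Rightarrow> ('o, 'm, 'p, 'n) functor_maps \<Rightarrow> bool" where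
  "op_fibration E B P \<longleftrightarrow> fibration (opposite E) (opposite B) P"

definition bifibration ::
  "('o, 'm) category \<Rightarrow> ('p, 'n) category \<Rightarrow> ('o, 'm, 'p, 'n) functor_maps \<Rightarrow> bool" where
  "bifibration E B P \<longleftrightarrow> fibration E B P \<and> op_fibration E B P"

end

theory Submission
  imports Defs
begin

text \<open>
  For a covering every morphism \<open>\<phi>\<close> is Cartesian: a given \<open>\<alpha>'\<close> lifts uniquely to some
  \<open>\<alpha>\<close> with codomain the domain of \<open>\<phi>\<close>, and \<open>\<phi> \<circ> \<alpha>\<close>, \<open>\<beta>\<close> then have the same codomain and
  the same image, hence are equal. Coverings are self-dual, so the op-fibration half
  follows by passing to opposite categories.
\<close>

lemma hom_set_opposite: "hom_set (opposite C) a b = hom_set C b a"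
  by (auto simp: hom_set_def opposite_def)

lemma small_category_opposite:
  assumes "small_category C"
  shows "small_category (opposite C)"
proof -
  interpret small_category C by fact
  show ?thesis
    by unfold_locales
      (auto simp: hom_set_opposite, auto simp: opposite_def Dom_Obj Cod_Obj Id_hom
        Comp_hom Comp_Id Id_Comp Comp_assoc)
qed

lemma cat_functor_opposite:
  assumes "cat_functor E B P"
  shows "cat_functor (opposite E) (opposite B) P"
proof -
  interpret cat_functor E B P by fact
  interpret oE: small_category "opposite E"
    by (rule small_category_opposite[OF E.small_category_axioms])
  interpret oB: small_category "opposite B"
    by (rule small_category_opposite[OF B.small_category_axioms])
  show ?thesis
    by unfold_locales
      (auto simp: hom_set_opposite, auto simp: opposite_def on_obj_Obj on_mor_hom
        on_mor_Id on_mor_Comp)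
qed

lemma mor_into_opposite: "mor_into (opposite C) c = mor_from C c"
  by (simp add: mor_into_def mor_from_def opposite_def)

lemma mor_from_opposite: "mor_from (opposite C) c = mor_into C c"
  by (simp add: mor_into_def mor_from_def opposite_def)

lemma Obj_opposite: "Obj (opposite C) = Obj C"
  by (simp add: opposite_def)

text \<open>Passing to opposites exchanges \<open>mor_into\<close> with \<open>mor_from\<close>, so
  the two bijectivity conditions of a covering trade places, while the object map stays the
  same.\<close>

lemma covering_opposite:
  assumes "covering E B P"
  shows "covering (opposite E) (opposite B) P"
  using assms cat_functor_opposite
  by (auto simp: covering_def mor_into_opposite mor_from_opposite Obj_opposite)

lemma covering_cartesian:
  assumes cov: "covering E B P" and \<phi>: "\<phi> \<in> Mor E"
  shows "cartesian E B P \<phi>"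
proof -
  interpret cat_functor E B P using cov by (simp add: covering_def)
  have bij: "bij_betw (on_mor P) (mor_into E c) (mor_into B (on_obj P c))" if "c \<in> Obj E" for c
    using cov that by (simp add: covering_def)
  \<comment> \<open>The domains \<open>a\<close> and \<open>b\<close> may differ: bijectivity on
    \<open>mor_into E c\<close> separates morphisms by their images once the codomain is
    fixed.\<close>
  have inj: "f = g" if "f \<in> hom_set E a c" "g \<in> hom_set E b c" "on_mor P f = on_mor P g" for a b c f g
  proof -
    have "c \<in> Obj E" using that(1) E.Cod_Obj by (auto simp: hom_set_def)
    then show ?thesis
      using that by (auto simp: hom_set_def mor_into_def intro: inj_onD[OF bij_betw_imp_inj_on[OF bij]])
  qed
  have \<phi>_hom: "\<phi> \<in> hom_set E (Dom E \<phi>) (Cod E \<phi>)" using \<phi> by (simp add: hom_set_def)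
  have "\<exists>!\<alpha>. \<alpha> \<in> hom_set E e (Dom E \<phi>) \<and> Comp E \<phi> \<alpha> = \<beta> \<and> on_mor P \<alpha> = \<alpha>'"
    if \<beta>: "\<beta> \<in> hom_set E e (Cod E \<phi>)"
      and \<alpha>': "\<alpha>' \<in> hom_set B (on_obj P e) (on_obj P (Dom E \<phi>))"
      and eq: "Comp B (on_mor P \<phi>) \<alpha>' = on_mor P \<beta>" for e \<beta> \<alpha>'
  proof -
    have "\<alpha>' \<in> on_mor P ` mor_into E (Dom E \<phi>)"
      using \<alpha>' bij_betw_imp_surj_on[OF bij[OF E.Dom_Obj[OF \<phi>]]] by (simp add: hom_set_def mor_into_def)
    \<comment> \<open>The lift is controlled only at its codomain. At this stage its domain is known
      to lie over \<open>on_obj P e\<close>, not yet to be \<open>e\<close>.\<close>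
    then obtain \<alpha> where \<alpha>: "\<alpha> \<in> hom_set E (Dom E \<alpha>) (Dom E \<phi>)" "on_mor P \<alpha> = \<alpha>'"
      by (auto simp: mor_into_def hom_set_def)
    have comp: "Comp E \<phi> \<alpha> \<in> hom_set E (Dom E \<alpha>) (Cod E \<phi>)"
      using E.Comp_hom[OF \<alpha>(1) \<phi>_hom] .
    have "Comp E \<phi> \<alpha> = \<beta>"
      using inj[OF comp \<beta>] on_mor_Comp[OF \<alpha>(1) \<phi>_hom] \<alpha>(2) eq by simp
    \<comment> \<open>The equation with \<beta> now identifies the domain of the lift, since a
      composite has the domain of its first factor.\<close>
    moreover from this have "Dom E \<alpha> = e"
      using comp \<beta> by (simp add: hom_set_def)
    ultimately show ?thesis
      \<comment> \<open>Uniqueness: competing lifts share the codomain \<open>Dom E \<phi>\<close>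
        and the image \<alpha>', so \<open>inj\<close> applies again.\<close>
      using \<alpha> inj by metis
  qed
  then show ?thesis using \<phi> by (simp add: cartesian_def)
qed

text \<open>Surjectivity on the morphisms into \<open>e2\<close> supplies a lift ending at
  \<open>e2\<close>, and in a covering any lift is Cartesian.\<close>

lemma covering_fibration:
  assumes cov: "covering E B P"
  shows "fibration E B P"
proof -
  interpret cat_functor E B P using cov by (simp add: covering_def)
  have "\<exists>e1 \<in> Obj E. \<exists>\<phi> \<in> hom_set E e1 e2. cartesian E B P \<phi> \<and> on_mor P \<phi> = \<phi>'"
    if "\<phi>' \<in> hom_set B b1 (on_obj P e2)" "e2 \<in> Obj E" for b1 e2 \<phi>'
  proof -
    have "\<phi>' \<in> on_mor P ` mor_into E e2"
      using that cov by (simp add: covering_def bij_betw_def hom_set_def mor_into_def)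
    then obtain \<phi> where "\<phi> \<in> Mor E" "Cod E \<phi> = e2" "on_mor P \<phi> = \<phi>'"
      by (auto simp: mor_into_def)
    then show ?thesis
      using covering_cartesian[OF cov] E.Dom_Obj by (auto simp: hom_set_def)
  qed
  then show ?thesis
    using cat_functor_axioms by (auto simp: fibration_def)
qed

theorem proposition2p12:
  fixes E :: "('o, 'm) category" and B :: "('p, 'n) category"
    and P :: "('o, 'm, 'p, 'n) functor_maps"
  assumes "covering E B P"
  shows "bifibration E B P"
  unfolding bifibration_def op_fibration_def
  using covering_fibration[OF assms] covering_fibration[OF covering_opposite[OF assms]] ..

end
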